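(* Let $X$ be a set, let $F$ be any set of functions from $X$ to $[0,1]$, let $\gamma>0$, and let $m$ be any positive integer. Then $$\mathcal L(F,m)\ \le\ \frac{\mathrm{fatV}_F(\gamma)}{m}+\gamma .$$
   Context: Prediction model: a prediction strategy for $X$ is a mapping $A$ from $\left(\bigcup_{k\ge 0}(X\times[0,1])^k\right)\times X$ to $[0,1]$. For a set $F$ of functions from $X$ to $[0,1]$ and a positive integer $m$, $$\mathcal L(F,m)=\inf_A\ \sup_{D,f}\ \mathbf E_{(x_1,\dots,x_m)\sim D^m}\Big[\big|A\big(((x_1,f(x_1)),\dots,(x_{m-1},f(x_{m-1}))),x_m\big)-f(x_m)\big|\Big],$$ where the infimum is over all prediction strategies and the supremum is over all probability distributions $D$ on $X$ and all $f\in F$. Dimension: for $r\in[0,1]$, $\gamma>0$, define $\psi_{r,\gamma}:[0,1]\to\{0,\star,1\}$ by $\psi_{r,\gamma}(y)=1$ if $y\ge r+\gamma$, $\psi_{r,\gamma}(y)=0$ if $y\le r-\gamma$, and $\psi_{r,\gamma}(y)=\star$ if $|y-r|<\gamma$. A sequence $x_1,\dots,x_d\in X$ is $\gamma$-fatly Vapnik-shattered by $F$ if there is a single $r\in[0,1]$ with $\{0,1\}^d\subseteq\{(\psi_{r,\gamma}(f(x_1)),\dots,\psi_{r,\gamma}(f(x_d))):f\in F\}$. $\mathrm{fatV}_F(\gamma)$ is the largest length $d$ of such a sequence ($\infty$ if lengths are unbounded, $0$ if no point is shattered). Convention: issues of measurability are ignored; the reader may assume that $X$ is countable with all subsets measurable.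 *)

theory Defs
  imports "HOL-Probability.Probability"
begin

definition prediction_strategies :: "'a set \<Rightarrow> (('a \<times> real) list \<times> 'a \<Rightarrow> real) set" where
  "prediction_strategies X = lists (X \<times> {0..1}) \<times> X \<rightarrow> {0..1}"

(* All subsets of X are measurable; this is meant to be used for countable X. *)
definition distributions :: "'a set \<Rightarrow> 'a measure set" where
  "distributions X = {D. prob_space D \<and> space D = X \<and> sets D = Pow X}"

definition expected_error ::
  "(('a \<times> real) list \<times> 'a \<Rightarrow> real) \<Rightarrow> 'a measure \<Rightarrow> ('a \<Rightarrow> real) \<Rightarrow> nat \<Rightarrow> ennreal" where
  "expected_error A D f m =
     (\<integral>\<^sup>+ x. ennreal \<bar>A (map (\<lambda>i. (x i, f (x i))) [1..<m], x m) - f (x m)\<bar>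
        \<partial>Pi\<^sub>M {1..m} (\<lambda>_. D))"

(* In ennreal the supremum of the empty set (F empty, or no distribution on X) is 0. *)
definition opt_loss :: "'a set \<Rightarrow> ('a \<Rightarrow> real) set \<Rightarrow> nat \<Rightarrow> ennreal" where
  "opt_loss X F m =
     (INF A\<in>prediction_strategies X. SUP (D, f)\<in>distributions X \<times> F. expected_error A D f m)"

datatype trit = Zero | Star | One

definition psi :: "real \<Rightarrow> real \<Rightarrow> real \<Rightarrow> trit" where
  "psi r \<gamma> y = (if y \<ge> r + \<gamma> then One else if y \<le> r - \<gamma> then Zero else Star)"

definition fatV_shattered :: "('a \<Rightarrow> real) set \<Rightarrow> real \<Rightarrow> 'a list \<Rightarrow> bool" where
  "fatV_shattered F \<gamma> xs \<longleftrightarrow>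
     (\<exists>r\<in>{0..1}. {bs. set bs \<subseteq> {Zero, One} \<and> length bs = length xs}
        \<subseteq> {map (\<lambda>x. psi r \<gamma> (f x)) xs | f. f \<in> F})"

(* In enat the supremum of the empty set is 0 and that of an unbounded set is infinity. *)
definition fatV :: "'a set \<Rightarrow> ('a \<Rightarrow> real) set \<Rightarrow> real \<Rightarrow> enat" where
  "fatV X F \<gamma> = (SUP xs\<in>{xs \<in> lists X. fatV_shattered F \<gamma> xs}. enat (length xs))"

end

theory Submission
  imports Defs
begin

text \<open>
  For a fixed threshold \<open>r\<close>, the functions that avoid \<open>Star\<close> on a finite set of points form a set family
  of VC dimension at most \<open>d = fatV X F \<gamma>\<close>. The one-inclusion graph of such a family has at most \<open>d\<close>
  edges per vertex in every induced subgraph, so it has an orientation with all outdegrees at most \<open>d\<close>,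
  and predicting along this orientation makes at most \<open>d\<close> leave-one-out mistakes. The strategy predicts
  the fraction of the thresholds \<open>r = k / N\<close>, \<open>k < N\<close>, that are predicted to lie below the value at the
  test point. Each mistake costs \<open>1 / N\<close>, the thresholds within \<open>\<gamma>\<close> of the true value cost at most
  \<open>\<gamma>\<close> in total, and exchangeability of the sample turns leave-one-out errors into the expected error.
  Finally \<open>N\<close> tends to infinity. Averaging over a grid instead of integrating over \<open>r\<close> avoids
  measurability in \<open>r\<close>.
\<close>

section \<open>Orientations of graphs with bounded outdegree\<close>

text \<open>Hakimi's orientation theorem. An edge can be added and given to one of its ends unless some tight
  vertex set contains that end only. If both choices are blocked, by tight \<open>S\<close> and \<open>T\<close>, the new edge
  violates the density condition on \<open>S \<union> T\<close>, since edge counts are supermodular.\<close>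

lemma orientation_with_bounded_outdegree:
  fixes s t :: "'e \<Rightarrow> 'v" and c :: "'v \<Rightarrow> int"
  assumes "finite E" and W: "finite W"
    and "\<And>e. e \<in> E \<Longrightarrow> s e \<in> W \<and> t e \<in> W \<and> s e \<noteq> t e"
    and "\<And>S. S \<subseteq> W \<Longrightarrow> int (card {e \<in> E. s e \<in> S \<and> t e \<in> S}) \<le> sum c S"
  shows "\<exists>h. (\<forall>e\<in>E. h e = s e \<or> h e = t e) \<and> (\<forall>v\<in>W. int (card {e \<in> E. h e = v}) \<le> c v)"
  using assms(1,3,4)
proof (induction E arbitrary: c rule: finite_induct)
  case empty
  have "0 \<le> c v" if "v \<in> W" for v
    using empty(2)[of "{v}"] that by simp
  then show ?case by simp
next
  case (insert e E)
  define n where "n = (\<lambda>S. {e \<in> E. s e \<in> S \<and> t e \<in> S})"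
  have fin: "finite (n S)" for S
    using insert.hyps(1) by (simp add: n_def)
  have both: "int (card (n S)) + 1 \<le> sum c S" if "S \<subseteq> W" "s e \<in> S" "t e \<in> S" for S
  proof -
    have "{e' \<in> insert e E. s e' \<in> S \<and> t e' \<in> S} = insert e (n S)"
      using that by (auto simp: n_def)
    moreover have "e \<notin> n S" using insert.hyps(2) by (simp add: n_def)
    ultimately show ?thesis
      using insert.prems(2)[OF that(1)] fin[of S] by simp
  qed
  have any: "int (card (n S)) \<le> sum c S" if "S \<subseteq> W" for S
  proof -
    have "card (n S) \<le> card {e' \<in> insert e E. s e' \<in> S \<and> t e' \<in> S}"
      using insert.hyps(1) by (intro card_mono) (auto simp: n_def)
    then show ?thesis using insert.prems(2)[OF that] by linarith
  qed
  have ends: "s e \<in> W" "t e \<in> W" "s e \<noteq> t e"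
    using insert.prems(1)[of e] by auto
  \<comment> \<open>Giving the new edge to \<open>q\<close> uses one unit of its capacity, so the
    induction hypothesis is applied with \<open>c q\<close> lowered by one. Only sets containing
    \<open>q\<close> lose room, and those containing both ends can afford it by
    \<open>both\<close>.\<close>
  have extend: ?case
    if q: "q = s e \<or> q = t e"
      and slack: "\<And>S. \<lbrakk>S \<subseteq> W; q \<in> S; \<not> (s e \<in> S \<and> t e \<in> S)\<rbrakk> \<Longrightarrow> int (card (n S)) < sum c S" for q
  proof -
    have "q \<in> W" using q ends by auto
    have "\<exists>h. (\<forall>e\<in>E. h e = s e \<or> h e = t e) \<and>
        (\<forall>v\<in>W. int (card {e \<in> E. h e = v}) \<le> (c(q := c q - 1)) v)"
    proof (rule insert.IH)
      show "s e \<in> W \<and> t e \<in> W \<and> s e \<noteq> t e" if "e \<in> E" for e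
        using insert.prems(1) that by simp
      show "int (card {e \<in> E. s e \<in> S \<and> t e \<in> S}) \<le> sum (c(q := c q - 1)) S" if S: "S \<subseteq> W" for S
      proof (cases "q \<in> S")
        case True
        have "finite S" using S W finite_subset by blast
        then have "sum (c(q := c q - 1)) S = sum c S - 1"
          using True by (simp add: sum.remove[of S q])
        moreover have "int (card (n S)) < sum c S"
          using slack[OF S True] both[OF S] by force
        ultimately show ?thesis by (simp add: n_def)
      next
        case False
        then have "sum (c(q := c q - 1)) S = sum c S"
          by (intro sum.cong) auto
        then show ?thesis using any[OF S] by (simp add: n_def)
      qed
    qed
    then obtain h where h: "\<forall>e\<in>E. h e = s e \<or> h e = t e"
      "\<forall>v\<in>W. int (card {e \<in> E. h e = v}) \<le> (c(q := c q - 1)) v" by blast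
    have "int (card {e' \<in> insert e E. (h(e := q)) e' = v}) \<le> c v" if v: "v \<in> W" for v
    proof (cases "v = q")
      case True
      have "{e' \<in> insert e E. (h(e := q)) e' = v} = insert e {e' \<in> E. h e' = v}"
        using True insert.hyps(2) by auto
      then show ?thesis using bspec[OF h(2) v] True insert.hyps by simp
    next
      case False
      have "{e' \<in> insert e E. (h(e := q)) e' = v} = {e' \<in> E. h e' = v}"
        using False insert.hyps(2) by auto
      then show ?thesis using bspec[OF h(2) v] False by simp
    qed
    moreover have "\<forall>e'\<in>insert e E. (h(e := q)) e' = s e' \<or> (h(e := q)) e' = t e'"
      using h(1) q by auto
    ultimately show ?thesis by blast
  qed
  show ?case
  proof (rule ccontr)
    assume "\<not> ?case"
    note stuck = this
    obtain S where S: "S \<subseteq> W" "s e \<in> S" "t e \<notin> S" "sum c S \<le> int (card (n S))"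
      using extend[of "s e"] stuck not_less by blast
    obtain T where T: "T \<subseteq> W" "t e \<in> T" "s e \<notin> T" "sum c T \<le> int (card (n T))"
      using extend[of "t e"] stuck not_less by blast
    have "card (n S) + card (n T) = card (n S \<union> n T) + card (n S \<inter> n T)"
      by (rule card_Un_Int) (rule fin)+
    also have "card (n S \<union> n T) \<le> card (n (S \<union> T))"
      by (rule card_mono[OF fin]) (auto simp: n_def)
    also have "n S \<inter> n T = n (S \<inter> T)"
      by (auto simp: n_def)
    finally have "card (n S) + card (n T) \<le> card (n (S \<union> T)) + card (n (S \<inter> T))" by simp
    moreover have "sum c (S \<union> T) + sum c (S \<inter> T) = sum c S + sum c T"
      using S(1) T(1) W by (intro sum.union_inter) (auto intro: finite_subset)
    moreover have "int (card (n (S \<union> T))) + 1 \<le> sum c (S \<union> T)"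
      using S T by (intro both) auto
    moreover have "int (card (n (S \<inter> T))) \<le> sum c (S \<inter> T)"
      using S(1) by (intro any) auto
    ultimately show False using S(4) T(4) by linarith
  qed
qed

section \<open>Density of one-inclusion graphs\<close>

definition shatters :: "'a set set \<Rightarrow> 'a set \<Rightarrow> bool" where
  "shatters V S \<longleftrightarrow> (\<forall>R\<subseteq>S. \<exists>v\<in>V. S \<inter> v = R)"

text \<open>A pair \<open>(w, x)\<close> encodes the undirected edge between \<open>w\<close> and
  \<open>insert x w\<close>; as \<open>x\<close> is not in \<open>w\<close>, each edge of the
  one-inclusion graph occurs exactly once.\<close>

definition inclusion_edges :: "'a set set \<Rightarrow> ('a set \<times> 'a) set" where
  "inclusion_edges V = {(w, x). x \<notin> w \<and> w \<in> V \<and> insert x w \<in> V}"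

lemma shatters_mono: "shatters V S \<Longrightarrow> V \<subseteq> V' \<Longrightarrow> shatters V' S"
  unfolding shatters_def by (meson subsetD)

lemma inclusion_edges_subset:
  assumes "V \<subseteq> Pow P" shows "inclusion_edges V \<subseteq> V \<times> P"
  using assms by (auto simp: inclusion_edges_def)

lemma finite_inclusion_edges:
  assumes "finite P" "V \<subseteq> Pow P" shows "finite (inclusion_edges V)"
  using assms inclusion_edges_subset[OF assms(2)]
  by (meson finite_Pow_iff finite_SigmaI finite_subset)

text \<open>Induction on the ground set: with \<open>V0\<close> and \<open>V1\<close> the two sections of \<open>V\<close> at \<open>p\<close>, the family \<open>V0 \<union> V1\<close>
  has dimension at most \<open>d\<close> and \<open>V0 \<inter> V1\<close> at most \<open>d - 1\<close>. The bound \<open>d\<close> is an integer so that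
  the case \<open>d = 0\<close>, where \<open>V0 \<inter> V1\<close> is empty, needs no separate treatment.\<close>

lemma card_inclusion_edges_le:
  fixes d :: int
  assumes "finite P" "V \<subseteq> Pow P" "\<And>S. shatters V S \<Longrightarrow> int (card S) \<le> d"
  shows "int (card (inclusion_edges V)) \<le> d * int (card V)"
  using assms
proof (induction P arbitrary: V d rule: finite_induct)
  case empty
  then consider "V = {}" | "V = {{}}" by (auto simp: subset_singleton_iff)
  then show ?case
  proof cases
    case 2
    \<comment> \<open>The empty set is shattered by the family \<open>{{}}\<close>, which gives 0
      \<le> \<open>d\<close>.\<close>
    then show ?thesis using empty(2)[of "{}"] by (simp add: inclusion_edges_def shatters_def)
  qed (simp add: inclusion_edges_def)
next
  case (insert p P)
  define V0 where "V0 = {v \<in> V. p \<notin> v}"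
  define V1 where "V1 = {v. p \<notin> v \<and> insert p v \<in> V}"
  have V0: "V0 \<subseteq> Pow P" and V1: "V1 \<subseteq> Pow P"
    using insert.prems(1) by (auto simp: V0_def V1_def)
  have fV: "finite V0" "finite V1"
    using V0 V1 insert.hyps(1) by (auto intro: finite_subset)
  note fE = finite_inclusion_edges[OF insert.hyps(1)]
  have "v \<in> insert p ` V1" if "v \<in> V" "p \<in> v" for v
    using that by (intro image_eqI[of _ _ "v - {p}"]) (simp_all add: V1_def insert_absorb)
  then have "V = V0 \<union> insert p ` V1"
    by (auto simp: V0_def V1_def)
  moreover have "V0 \<inter> insert p ` V1 = {}" by (auto simp: V0_def)
  moreover have "inj_on (insert p) V1"
    by (rule inj_onI) (simp add: V1_def insert_ident)
  ultimately have cardV: "card V = card V0 + card V1"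
    using fV by (simp add: card_Un_disjoint card_image)
  \<comment> \<open>Edges of \<open>V\<close> come in three kinds: both ends avoid \<open>p\<close>,
    both contain \<open>p\<close>, or the ends differ exactly in \<open>p\<close>.\<close>
  have split: "inclusion_edges V \<subseteq> inclusion_edges V0 \<union> map_prod (insert p) id ` inclusion_edges V1
      \<union> (\<lambda>w. (w, p)) ` (V0 \<inter> V1)" (is "_ \<subseteq> ?A \<union> ?B \<union> ?C")
  proof clarify
    fix w x assume e: "(w, x) \<in> inclusion_edges V" "(w, x) \<notin> ?C" "(w, x) \<notin> ?B"
    show "(w, x) \<in> ?A"
    proof (cases "p \<in> w")
      case True
      then obtain w' where w': "w = insert p w'" "p \<notin> w'" by (metis mk_disjoint_insert)
      then have "(w', x) \<in> inclusion_edges V1"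
        using e(1) by (auto simp: inclusion_edges_def V1_def insert_commute)
      then have "map_prod (insert p) id (w', x) \<in> ?B" by (rule imageI)
      then show ?thesis using e(3) w' by simp
    next
      case False
      then show ?thesis using e(1,2)
        by (auto simp: inclusion_edges_def V0_def V1_def)
    qed
  qed
  have "card (inclusion_edges V) \<le> card (?A \<union> ?B \<union> ?C)"
    using fE[OF V0] fE[OF V1] fV by (intro card_mono split) auto
  also have "\<dots> \<le> card ?A + card ?B + card ?C"
    by (meson card_Un_le add_right_mono order_trans)
  also have "\<dots> \<le> card ?A + card (inclusion_edges V1) + card (V0 \<inter> V1)"
    using fE[OF V1] fV by (intro add_mono card_image_le) auto
  \<comment> \<open>Edges common to both sections are counted twice: once in the union of the
    sections and once in their intersection.\<close>
  also have "card ?A + card (inclusion_edges V1) =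
      card (?A \<union> inclusion_edges V1) + card (?A \<inter> inclusion_edges V1)"
    using fE[OF V0] fE[OF V1] by (rule card_Un_Int)
  also have "card (?A \<union> inclusion_edges V1) \<le> card (inclusion_edges (V0 \<union> V1))"
    using V0 V1 by (intro card_mono fE) (auto simp: inclusion_edges_def)
  also have "?A \<inter> inclusion_edges V1 = inclusion_edges (V0 \<inter> V1)"
    by (auto simp: inclusion_edges_def)
  finally have "card (inclusion_edges V) \<le> card (inclusion_edges (V0 \<union> V1))
      + card (inclusion_edges (V0 \<inter> V1)) + card (V0 \<inter> V1)" by simp
  moreover have "int (card (inclusion_edges (V0 \<union> V1))) \<le> d * int (card (V0 \<union> V1))"
  proof (rule insert.IH)
    show "V0 \<union> V1 \<subseteq> Pow P" using V0 V1 by simp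
    fix S assume S: "shatters (V0 \<union> V1) S"
    then obtain u where "u \<in> V0 \<union> V1" "S \<inter> u = S" unfolding shatters_def by blast
    then have "p \<notin> S" by (auto simp: V0_def V1_def)
    \<comment> \<open>A member of \<open>V1\<close> regains \<open>p\<close> without changing its
      trace on \<open>S\<close>, since \<open>p\<close> is not in \<open>S\<close>.\<close>
    have "\<exists>v'\<in>V. S \<inter> v' = S \<inter> v" if "v \<in> V0 \<union> V1" for v
    proof (cases "v \<in> V")
      case False
      then have "insert p v \<in> V" "S \<inter> insert p v = S \<inter> v"
        using that \<open>p \<notin> S\<close> by (auto simp: V0_def V1_def)
      then show ?thesis by blast
    qed blast
    then have "shatters V S" using S unfolding shatters_def by metis
    then show "int (card S) \<le> d" by (rule insert.prems(2))
  qed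
  moreover have "int (card (inclusion_edges (V0 \<inter> V1))) \<le> (d - 1) * int (card (V0 \<inter> V1))"
  proof (rule insert.IH)
    show "V0 \<inter> V1 \<subseteq> Pow P" using V0 by auto
    fix S assume S: "shatters (V0 \<inter> V1) S"
    then obtain u where u: "u \<in> V0 \<inter> V1" "S \<inter> u = S" unfolding shatters_def by blast
    then have pS: "p \<notin> S" by (auto simp: V0_def)
    have "S \<subseteq> P" using u V0 by blast
    then have "finite S" using insert.hyps(1) finite_subset by blast
    \<comment> \<open>Each \<open>v\<close> in both sections lies in \<open>V\<close> with and
      without \<open>p\<close>, so membership of \<open>p\<close> can be chosen freely.\<close>
    have "shatters V (insert p S)"
      unfolding shatters_def
    proof (intro allI impI)
      fix R assume R: "R \<subseteq> insert p S"
      then have "R - {p} \<subseteq> S" by auto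
      then obtain v where v: "v \<in> V0" "v \<in> V1" "S \<inter> v = R - {p}"
        using S unfolding shatters_def by blast
      show "\<exists>v\<in>V. insert p S \<inter> v = R"
      proof (cases "p \<in> R")
        case True
        have "insert p v \<in> V" using v by (simp add: V1_def)
        moreover have "insert p S \<inter> insert p v = R" using True v by auto
        ultimately show ?thesis by blast
      next
        case False
        have "v \<in> V" "insert p S \<inter> v = R" using False v by (auto simp: V0_def)
        then show ?thesis by blast
      qed
    qed
    then have "int (card (insert p S)) \<le> d" by (rule insert.prems(2))
    then show "int (card S) \<le> d - 1" using pS \<open>finite S\<close> by simp
  qed
  \<comment> \<open>The last summand \<open>card (V0 \<inter> V1)\<close>, from the edges in
    direction \<open>p\<close>, raises the factor \<open>d - 1\<close> to \<open>d\<close>, so both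
    terms add up to \<open>d\<close> times \<open>card V\<close>.\<close>
  moreover have "card V = card (V0 \<union> V1) + card (V0 \<inter> V1)"
    using cardV card_Un_Int[OF fV] by simp
  ultimately show ?case by (simp add: algebra_simps)
qed

text \<open>\<open>pr w x\<close> predicts whether \<open>x\<close> belongs to a member of \<open>V\<close> that is known to equal \<open>w\<close> away from \<open>x\<close>.\<close>

lemma one_inclusion_predictor:
  assumes "finite P" and V: "V \<subseteq> Pow P" and d: "\<And>S. shatters V S \<Longrightarrow> card S \<le> d"
  shows "\<exists>pr. \<forall>v\<in>V. card {x \<in> P. pr (v - {x}) x \<noteq> (x \<in> v)} \<le> d"
proof -
  define E where "E = inclusion_edges V"
  have finV: "finite V" using assms by (auto intro: finite_subset)
  have finE: "finite E" unfolding E_def using assms(1) V by (rule finite_inclusion_edges)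
  have "\<exists>h. (\<forall>e\<in>E. h e = fst e \<or> h e = insert (snd e) (fst e)) \<and>
      (\<forall>v\<in>V. int (card {e \<in> E. h e = v}) \<le> int d)"
  proof (rule orientation_with_bounded_outdegree[OF finE finV])
    show "fst e \<in> V \<and> insert (snd e) (fst e) \<in> V \<and> fst e \<noteq> insert (snd e) (fst e)"
      if "e \<in> E" for e
      using that by (auto simp: E_def inclusion_edges_def)
    fix S assume S: "S \<subseteq> V"
    have "{e \<in> E. fst e \<in> S \<and> insert (snd e) (fst e) \<in> S} = inclusion_edges S"
      using S by (auto simp: E_def inclusion_edges_def)
    moreover have "int (card (inclusion_edges S)) \<le> int d * int (card S)"
    proof (rule card_inclusion_edges_le[OF assms(1)])
      show "S \<subseteq> Pow P" using S V by simp
      fix T assume "shatters S T"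
      then have "shatters V T" using S by (rule shatters_mono)
      then show "int (card T) \<le> int d" using d by simp
    qed
    ultimately show "int (card {e \<in> E. fst e \<in> S \<and> insert (snd e) (fst e) \<in> S}) \<le> (\<Sum>v\<in>S. int d)"
      by (simp add: mult.commute)
  qed
  then obtain h where h: "\<And>e. e \<in> E \<Longrightarrow> h e = fst e \<or> h e = insert (snd e) (fst e)"
    and deg: "\<And>v. v \<in> V \<Longrightarrow> card {e \<in> E. h e = v} \<le> d" by auto
  \<comment> \<open>\<open>h e\<close> is the tail of the edge, and the prediction follows the edge
    to its head. Where there is no edge, at most one candidate lies in \<open>V\<close>.\<close>
  define pr where "pr = (\<lambda>w x. insert x w \<in> V \<and> ((w, x) \<in> E \<longrightarrow> h (w, x) = w))"
  have "card {x \<in> P. pr (v - {x}) x \<noteq> (x \<in> v)} \<le> d" if v: "v \<in> V" for v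
  proof -
    \<comment> \<open>A mistake at \<open>x\<close> means that the edge at \<open>v\<close> in
      direction \<open>x\<close> exists and leaves \<open>v\<close>.\<close>
    have "(v - {x}, x) \<in> {e \<in> E. h e = v}" if x: "pr (v - {x}) x \<noteq> (x \<in> v)" for x
    proof (cases "x \<in> v")
      case True
      then have "insert x (v - {x}) = v" by auto
      then show ?thesis using x True v h[of "(v - {x}, x)"] by (auto simp: pr_def)
    next
      case False
      then have "v - {x} = v" by auto
      then show ?thesis using x False v
        by (auto simp: pr_def E_def inclusion_edges_def)
    qed
    then have sub: "(\<lambda>x. (v - {x}, x)) ` {x \<in> P. pr (v - {x}) x \<noteq> (x \<in> v)} \<subseteq> {e \<in> E. h e = v}"
      by auto
    have inj: "inj_on (\<lambda>x. (v - {x}, x)) {x \<in> P. pr (v - {x}) x \<noteq> (x \<in> v)}"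
      by (auto intro: inj_onI)
    have "finite {e \<in> E. h e = v}" using finE by simp
    then show ?thesis using card_inj_on_le[OF inj sub] deg[OF v] by linarith
  qed
  then show ?thesis by blast
qed


section \<open>Prediction at a fixed threshold\<close>

text \<open>Training points whose label is \<open>Star\<close> at threshold \<open>r\<close> are dropped, so that the remaining
  ones carry a total binary labelling and the one-inclusion predictor applies.\<close>

definition vote ::
  "('a set \<Rightarrow> 'a set \<Rightarrow> 'a \<Rightarrow> bool) \<Rightarrow> real \<Rightarrow> real \<Rightarrow> ('a \<times> real) set \<Rightarrow> 'a \<Rightarrow> bool" where
  "vote pr r \<gamma> L x =
     (let T = {z. \<exists>y. (z, y) \<in> L \<and> psi r \<gamma> y \<noteq> Star}; U = {z. \<exists>y. (z, y) \<in> L \<and> psi r \<gamma> y = One}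
      in if x \<in> T then x \<in> U else pr (insert x T) U x)"

definition threshold_class :: "('a \<Rightarrow> real) set \<Rightarrow> real \<Rightarrow> real \<Rightarrow> 'a set \<Rightarrow> 'a set set" where
  "threshold_class F r \<gamma> P =
     {{x \<in> P. psi r \<gamma> (f x) = One} | f. f \<in> F \<and> (\<forall>x\<in>P. psi r \<gamma> (f x) \<noteq> Star)}"

text \<open>Listed without repetition, a shattered set is a fatly shattered sequence at the same
  \<open>r\<close>: it lies inside \<open>P\<close>, where the functions behind the class never take
  the label \<open>Star\<close>.\<close>

lemma card_le_fatV:
  assumes "shatters (threshold_class F r \<gamma> P) S" "finite P" "P \<subseteq> X" "r \<in> {0..1}"
    "fatV X F \<gamma> = enat d"
  shows "card S \<le> d"
proof -
  obtain u where "u \<in> threshold_class F r \<gamma> P" "S \<inter> u = S"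
    using assms(1) unfolding shatters_def by blast
  then have "S \<subseteq> P" by (auto simp: threshold_class_def)
  then have "finite S" using assms(2) finite_subset by blast
  then obtain xs where xs: "set xs = S" "distinct xs"
    using finite_distinct_list by blast
  have "\<exists>f\<in>F. bs = map (\<lambda>x. psi r \<gamma> (f x)) xs"
    if bs: "set bs \<subseteq> {Zero, One}" "length bs = length xs" for bs
  proof -
    define R where "R = {xs ! i | i. i < length xs \<and> bs ! i = One}"
    have "R \<subseteq> S" using xs(1) by (auto simp: R_def)
    then obtain v where "v \<in> threshold_class F r \<gamma> P" "S \<inter> v = R"
      using assms(1) unfolding shatters_def by blast
    then obtain f where f: "f \<in> F" "\<forall>x\<in>P. psi r \<gamma> (f x) \<noteq> Star"
      "R = S \<inter> {x \<in> P. psi r \<gamma> (f x) = One}"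
      by (auto simp: threshold_class_def)
    have "bs ! i = psi r \<gamma> (f (xs ! i))" if i: "i < length xs" for i
    proof -
      have "xs ! i \<in> S" using i xs(1) by auto
      then have "xs ! i \<in> P" using \<open>S \<subseteq> P\<close> by blast
      have "bs ! i \<noteq> Star" using bs i nth_mem[of i bs] by force
      moreover have "psi r \<gamma> (f (xs ! i)) \<noteq> Star" using f(2) \<open>xs ! i \<in> P\<close> by blast
      \<comment> \<open>Distinctness of \<open>xs\<close> recovers the index \<open>i\<close> from
        the point \<open>xs ! i\<close>.\<close>
      moreover have "bs ! i = One \<longleftrightarrow> xs ! i \<in> R"
        using i xs(2) by (auto simp: R_def nth_eq_iff_index_eq)
      moreover have "xs ! i \<in> R \<longleftrightarrow> psi r \<gamma> (f (xs ! i)) = One"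
        using \<open>xs ! i \<in> P\<close> \<open>xs ! i \<in> S\<close> by (simp add: f(3))
      ultimately show ?thesis by (metis trit.exhaust)
    qed
    then have "bs = map (\<lambda>x. psi r \<gamma> (f x)) xs"
      using bs(2) by (simp add: list_eq_iff_nth_eq)
    then show ?thesis using f(1) by blast
  qed
  then have "fatV_shattered F \<gamma> xs"
    unfolding fatV_shattered_def using assms(4) by (intro bexI[of _ r]) auto
  moreover have "xs \<in> lists X" using xs(1) \<open>S \<subseteq> P\<close> assms(3) by (auto simp: lists_eq_set)
  ultimately have "enat (length xs) \<le> fatV X F \<gamma>"
    unfolding fatV_def by (intro SUP_upper) simp
  then show ?thesis using assms(5) xs distinct_card by fastforce
qed

text \<open>A test point that recurs in training has its label copied, so every mistake is at a
  point occurring once. There \<open>insert x T\<close> is the full set \<open>P\<close> of labelled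
  points, and the mistake is one of the at most \<open>d\<close> leave-one-out mistakes of the
  predictor for \<open>P\<close>.\<close>

lemma vote_mistakes:
  fixes X :: "'a set"
  assumes "r \<in> {0..1}" "fatV X F \<gamma> = enat d" and I: "finite I"
  shows "\<exists>pr. \<forall>f\<in>F. \<forall>x\<in>I \<rightarrow> X.
    card {i \<in> I. psi r \<gamma> (f (x i)) \<noteq> Star \<and>
      vote pr r \<gamma> ((\<lambda>j. (x j, f (x j))) ` (I - {i})) (x i) \<noteq> (psi r \<gamma> (f (x i)) = One)} \<le> d"
proof -
  have "\<exists>pr. \<forall>v\<in>threshold_class F r \<gamma> P. card {x \<in> P. pr (v - {x}) x \<noteq> (x \<in> v)} \<le> d"
    if P: "finite P" "P \<subseteq> X" for P
    using P(1)
  proof (rule one_inclusion_predictor)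
    show "threshold_class F r \<gamma> P \<subseteq> Pow P" by (auto simp: threshold_class_def)
  qed (rule card_le_fatV[OF _ P assms(1,2)])
  \<comment> \<open>The predictor depends on \<open>P\<close> only and not on the target
    \<open>f\<close>, so a strategy can use it.\<close>
  then obtain pr where pr: "\<And>P v. \<lbrakk>finite P; P \<subseteq> X; v \<in> threshold_class F r \<gamma> P\<rbrakk> \<Longrightarrow>
      card {x \<in> P. pr P (v - {x}) x \<noteq> (x \<in> v)} \<le> d"
    using bchoice[of "{P. finite P \<and> P \<subseteq> X}"
      "\<lambda>P pr. \<forall>v\<in>threshold_class F r \<gamma> P. card {x \<in> P. pr (v - {x}) x \<noteq> (x \<in> v)} \<le> d"]
    by blast
  have "card {i \<in> I. psi r \<gamma> (f (x i)) \<noteq> Star \<and>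
      vote pr r \<gamma> ((\<lambda>j. (x j, f (x j))) ` (I - {i})) (x i) \<noteq> (psi r \<gamma> (f (x i)) = One)} \<le> d"
    (is "card ?M \<le> d") if f: "f \<in> F" and x: "x \<in> I \<rightarrow> X" for f x
  proof -
    define P where "P = {z \<in> x ` I. psi r \<gamma> (f z) \<noteq> Star}"
    define v where "v = {z \<in> P. psi r \<gamma> (f z) = One}"
    have P: "finite P" "P \<subseteq> X" using I x by (auto simp: P_def)
    have v: "v \<in> threshold_class F r \<gamma> P"
      using f unfolding threshold_class_def v_def by (auto simp: P_def)
    have mistake: "x i \<notin> x ` (I - {i}) \<and> x i \<in> P \<and> pr P (v - {x i}) (x i) \<noteq> (x i \<in> v)"
      if i: "i \<in> ?M" for i
    proof -
      define L where "L = (\<lambda>j. (x j, f (x j))) ` (I - {i})"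
      define T where "T = {z \<in> x ` (I - {i}). psi r \<gamma> (f z) \<noteq> Star}"
      define U where "U = {z \<in> x ` (I - {i}). psi r \<gamma> (f z) = One}"
      have "{z. \<exists>y. (z, y) \<in> L \<and> psi r \<gamma> y \<noteq> Star} = T" "{z. \<exists>y. (z, y) \<in> L \<and> psi r \<gamma> y = One} = U"
        by (auto simp: L_def T_def U_def)
      then have vote: "vote pr r \<gamma> L (x i) = (if x i \<in> T then x i \<in> U else pr (insert (x i) T) U (x i))"
        by (simp add: vote_def)
      have i': "i \<in> I" "psi r \<gamma> (f (x i)) \<noteq> Star" "vote pr r \<gamma> L (x i) \<noteq> (psi r \<gamma> (f (x i)) = One)"
        using i by (auto simp: L_def)
      have notin: "x i \<notin> x ` (I - {i})"
        using i' vote by (auto simp: T_def U_def split: if_splits)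
      then have "x i \<notin> T" by (simp add: T_def)
      moreover have "insert (x i) T = P" using i' by (auto simp: T_def P_def)
      moreover have "x ` (I - {i}) = x ` I - {x i}" using notin by blast
      then have "U = v - {x i}" by (auto simp: U_def v_def P_def)
      moreover have "x i \<in> v \<longleftrightarrow> psi r \<gamma> (f (x i)) = One" using i' by (auto simp: v_def P_def)
      ultimately show ?thesis using notin i' vote by auto
    qed
    have "inj_on x ?M"
    proof (rule inj_onI, rule ccontr)
      fix i j assume "i \<in> ?M" "j \<in> ?M" "x i = x j" "i \<noteq> j"
      then have "x i \<in> x ` (I - {i})" by auto
      then show False using mistake[OF \<open>i \<in> ?M\<close>] by blast
    qed
    moreover have "x ` ?M \<subseteq> {z \<in> P. pr P (v - {z}) z \<noteq> (z \<in> v)}"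
      using mistake by blast
    ultimately have "card ?M \<le> card {z \<in> P. pr P (v - {z}) z \<noteq> (z \<in> v)}"
      using P(1) by (intro card_inj_on_le[of x]) auto
    then show ?thesis using pr[OF P v] by linarith
  qed
  then show ?thesis by blast
qed

section \<open>Averaging over a grid of thresholds\<close>

text \<open>The thresholds within \<open>\<gamma>\<close> of \<open>y\<close> cost only \<open>\<gamma>\<close> and not \<open>2\<gamma>\<close>: those below \<open>y\<close> can only lower
  the average and those above can only raise it. The term \<open>1 / N\<close> is the discretisation error.\<close>

lemma grid_average_error:
  fixes y \<gamma> :: real and N :: nat
  assumes y: "y \<in> {0..1}" and N: "N > 0" and \<gamma>: "\<gamma> > 0"
  shows "\<bar>real (card {k \<in> {..<N}. b k}) / real N - y\<bar> \<le> \<gamma> + 1 / real N +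
    real (card {k \<in> {..<N}. psi (real k / real N) \<gamma> y \<noteq> Star \<and>
      b k \<noteq> (psi (real k / real N) \<gamma> y = One)}) / real N"
    (is "\<bar>real (card ?B) / _ - y\<bar> \<le> _ + real (card ?M) / _")
proof -
  \<comment> \<open>\<open>?up\<close> collects the thresholds not labelled \<open>Zero\<close>,
    \<open>?low\<close> those labelled \<open>One\<close>. Up to the mistakes \<open>?M\<close>, the
    positive votes \<open>?B\<close> lie inside \<open>?up\<close> and cover
    \<open>?low\<close>.\<close>
  let ?up = "{k. real k < real N * (y + \<gamma>)}" and ?low = "{k \<in> {..<N}. real k \<le> real N * (y - \<gamma>)}"
  have pos: "0 < real N" using N by simp
  have One: "psi (real k / real N) \<gamma> y = One \<longleftrightarrow> real k \<le> real N * (y - \<gamma>)" for k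
    using pos by (auto simp: psi_def field_simps)
  have Zero: "psi (real k / real N) \<gamma> y = Zero \<longleftrightarrow> \<not> real k < real N * (y + \<gamma>)" for k
    using pos mult_pos_pos[OF \<gamma> pos] by (auto simp: psi_def field_simps)
  have up: "?up = {..<nat \<lceil>real N * (y + \<gamma>)\<rceil>}" by (auto simp: less_ceiling_iff zless_nat_eq_int_zless)
  have "finite ?up" unfolding up by simp
  moreover have "?B \<subseteq> ?M \<union> ?up" using Zero by force
  ultimately have "card ?B \<le> card (?M \<union> ?up)" by (intro card_mono) auto
  also have "\<dots> \<le> card ?M + card ?up" by (rule card_Un_le)
  also have "card ?up = nat \<lceil>real N * (y + \<gamma>)\<rceil>" by (simp add: up)
  finally have "real (card ?B) \<le> real (card ?M) + real (nat \<lceil>real N * (y + \<gamma>)\<rceil>)" by linarith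
  \<comment> \<open>Rounding up costs the 1 that becomes \<open>1 / N\<close>; the lower estimate
    loses nothing.\<close>
  also have "real (nat \<lceil>real N * (y + \<gamma>)\<rceil>) \<le> real N * (y + \<gamma>) + 1"
    using y \<gamma> pos by (simp add: of_nat_nat)
  finally have upper: "real (card ?B) \<le> real (card ?M) + (real N * (y + \<gamma>) + 1)" by simp
  have "{..<min N (nat \<lceil>real N * (y - \<gamma>)\<rceil>)} \<subseteq> ?low"
    by (auto simp: zless_nat_eq_int_zless less_ceiling_iff)
  then have "card {..<min N (nat \<lceil>real N * (y - \<gamma>)\<rceil>)} \<le> card ?low" by (intro card_mono) auto
  also have "?low \<subseteq> ?M \<union> ?B" using One by force
  then have "card ?low \<le> card (?M \<union> ?B)" by (intro card_mono) auto
  also have "\<dots> \<le> card ?M + card ?B" by (rule card_Un_le)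
  finally have "real (min N (nat \<lceil>real N * (y - \<gamma>)\<rceil>)) \<le> real (card ?M) + real (card ?B)" by simp
  moreover have "real N * (y - \<gamma>) \<le> real N" using y \<gamma> pos by simp
  then have "real N * (y - \<gamma>) \<le> real (min N (nat \<lceil>real N * (y - \<gamma>)\<rceil>))" by linarith
  ultimately have lower: "real N * (y - \<gamma>) \<le> real (card ?M) + real (card ?B)" by linarith
  have "\<bar>real (card ?B) - real N * y\<bar> \<le> real N * \<gamma> + 1 + real (card ?M)"
    using upper lower by (simp add: algebra_simps abs_le_iff)
  then have "\<bar>real (card ?B) - real N * y\<bar> / real N \<le> (real N * \<gamma> + 1 + real (card ?M)) / real N"
    using pos by (intro divide_right_mono) auto
  moreover have "\<bar>real (card ?B) - real N * y\<bar> / real N = \<bar>real (card ?B) / real N - y\<bar>"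
  proof -
    have "real (card ?B) / real N - y = (real (card ?B) - real N * y) / real N"
      using pos by (simp add: diff_divide_distrib)
    then show ?thesis by (simp only: abs_divide of_nat_0_le_iff abs_of_nonneg)
  qed
  ultimately show ?thesis using pos by (simp add: add_divide_distrib)
qed

section \<open>Exchangeability of the sample\<close>

text \<open>A finite power of a countable set is countable, so every subset is a countable union of
  measurable singletons. Hence every integrand on samples is measurable.\<close>

lemma sets_PiM_countable:
  assumes "countable X" "finite I" "space D = X" "sets D = Pow X"
  shows "sets (Pi\<^sub>M I (\<lambda>_. D)) = Pow (I \<rightarrow>\<^sub>E X)"
proof
  show "sets (Pi\<^sub>M I (\<lambda>_. D)) \<subseteq> Pow (I \<rightarrow>\<^sub>E X)"
    using sets.sets_into_space[of _ "Pi\<^sub>M I (\<lambda>_. D)"] assms(3) by (auto simp: space_PiM)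
  show "Pow (I \<rightarrow>\<^sub>E X) \<subseteq> sets (Pi\<^sub>M I (\<lambda>_. D))"
  proof
    fix A assume A: "A \<in> Pow (I \<rightarrow>\<^sub>E X)"
    have "countable (I \<rightarrow>\<^sub>E X)" using assms(1,2) by (intro countable_PiE) auto
    then have "countable A" using A countable_subset by blast
    moreover have "{x} \<in> sets (Pi\<^sub>M I (\<lambda>_. D))" if "x \<in> A" for x
    proof -
      have x: "x \<in> I \<rightarrow>\<^sub>E X" using A that by blast
      then have "{x} = (\<Pi>\<^sub>E i\<in>I. {x i})" by (intro PiE_singleton[symmetric]) (simp add: PiE_iff)
      also have "\<dots> \<in> sets (Pi\<^sub>M I (\<lambda>_. D))"
        using x assms by (intro sets_PiM_I_finite) auto
      finally show ?thesis .
    qed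
    ultimately show "A \<in> sets (Pi\<^sub>M I (\<lambda>_. D))"
      using sets.countable_UN'[of A "\<lambda>x. {x}" "Pi\<^sub>M I (\<lambda>_. D)"] by (simp add: image_subset_iff)
  qed
qed

abbreviation (input) swap :: "'i \<Rightarrow> 'i \<Rightarrow> 'i \<Rightarrow> 'i" where
  "swap \<equiv> Transposition.transpose"

text \<open>The coordinates are independent and equally distributed, so exchanging two of them
  preserves the product measure.\<close>

lemma nn_integral_PiM_transpose:
  assumes "prob_space D" "i \<in> I" "j \<in> I" "g \<in> borel_measurable (Pi\<^sub>M I (\<lambda>_. D))"
  shows "(\<integral>\<^sup>+ x. g (\<lambda>k\<in>I. x (swap i j k)) \<partial>Pi\<^sub>M I (\<lambda>_. D)) = (\<integral>\<^sup>+ x. g x \<partial>Pi\<^sub>M I (\<lambda>_. D))"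
proof -
  have maps: "swap i j \<in> I \<rightarrow> I" using assms(2,3) by (auto simp: Transposition.transpose_def)
  then have "distr (Pi\<^sub>M I (\<lambda>_. D)) (Pi\<^sub>M I (\<lambda>_. D)) (\<lambda>x. \<lambda>k\<in>I. x (swap i j k)) = Pi\<^sub>M I (\<lambda>_. D)"
    using assms(1) by (intro distr_PiM_reindex) auto
  moreover have "(\<lambda>x. \<lambda>k\<in>I. x (swap i j k)) \<in> Pi\<^sub>M I (\<lambda>_. D) \<rightarrow>\<^sub>M Pi\<^sub>M I (\<lambda>_. D)"
    using maps by (intro measurable_restrict measurable_component_singleton) auto
  ultimately show ?thesis
    using nn_integral_distr[of _ "Pi\<^sub>M I (\<lambda>_. D)" "Pi\<^sub>M I (\<lambda>_. D)" g] assms(4) by metis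
qed

text \<open>By exchangeability, the expected error is the expectation of the average leave-one-out error.\<close>

lemma expected_error_le:
  fixes X :: "'a set" and K :: real
  assumes X: "countable X" and D: "D \<in> distributions X" and m: "m > 0"
    and A: "\<And>x. x \<in> {1..m} \<rightarrow> X \<Longrightarrow>
      (\<Sum>i\<in>{1..m}. \<bar>A (map (\<lambda>k. (x (swap i m k), f (x (swap i m k)))) [1..<m], x i) - f (x i)\<bar>)
        \<le> real m * K"
  shows "expected_error A D f m \<le> ennreal K"
proof -
  let ?P = "Pi\<^sub>M {1..m} (\<lambda>_. D)"
  define g where "g = (\<lambda>x. ennreal \<bar>A (map (\<lambda>i. (x i, f (x i))) [1..<m], x m) - f (x m)\<bar>)"
  have D': "prob_space D" "space D = X" "sets D = Pow X"
    using D by (auto simp: distributions_def)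
  have P: "prob_space ?P" using D'(1) by (intro prob_space_PiM)
  have meas: "h \<in> borel_measurable ?P" for h :: "_ \<Rightarrow> ennreal"
    using sets_PiM_countable[OF X _ D'(2,3), of "{1..m}"]
    by (auto simp: measurable_def space_PiM D'(2))
  \<comment> \<open>Exchanging \<open>i\<close> and \<open>m\<close> makes \<open>x i\<close> the
    test point and moves \<open>x m\<close> to training position \<open>i\<close>; for
    \<open>i = m\<close> nothing moves.\<close>
  have g: "g (\<lambda>k\<in>{1..m}. x (swap i m k)) =
      ennreal \<bar>A (map (\<lambda>k. (x (swap i m k), f (x (swap i m k)))) [1..<m], x i) - f (x i)\<bar>" for x i
  proof -
    let ?x = "\<lambda>k\<in>{1..m}. x (swap i m k)"
    have "map (\<lambda>k. (?x k, f (?x k))) [1..<m] = map (\<lambda>k. (x (swap i m k), f (x (swap i m k)))) [1..<m]"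
      by simp
    then show ?thesis using m unfolding g_def by (simp only:) simp
  qed
  have "of_nat m * expected_error A D f m = (\<Sum>i\<in>{1..m}. \<integral>\<^sup>+ x. g x \<partial>?P)"
    by (simp add: expected_error_def g_def)
  also have "\<dots> = (\<Sum>i\<in>{1..m}. \<integral>\<^sup>+ x. g (\<lambda>k\<in>{1..m}. x (swap i m k)) \<partial>?P)"
    using m by (intro sum.cong refl nn_integral_PiM_transpose[symmetric] D'(1) meas) auto
  also have "\<dots> = (\<integral>\<^sup>+ x. (\<Sum>i\<in>{1..m}. g (\<lambda>k\<in>{1..m}. x (swap i m k))) \<partial>?P)"
    by (intro nn_integral_sum[symmetric] meas)
  also have "\<dots> \<le> (\<integral>\<^sup>+ x. ennreal (real m * K) \<partial>?P)"
  proof (rule nn_integral_mono)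
    fix x assume "x \<in> space ?P"
    then have "x \<in> {1..m} \<rightarrow> X" by (auto simp: space_PiM D'(2))
    then show "(\<Sum>i\<in>{1..m}. g (\<lambda>k\<in>{1..m}. x (swap i m k))) \<le> ennreal (real m * K)"
      unfolding g by (subst sum_ennreal) (simp, intro ennreal_leI A)
  qed
  also have "\<dots> = of_nat m * ennreal K"
    using prob_space.emeasure_space_1[OF P] by (simp add: ennreal_mult' ennreal_of_nat_eq_real_of_nat)
  finally have "of_nat m * expected_error A D f m \<le> of_nat m * ennreal K" .
  then show ?thesis
    using m by (subst (asm) ennreal_mult_le_mult_iff) auto
qed

section \<open>The strategy and its loss\<close>

lemma sum_card_swap:
  assumes "finite I" "finite J"
  shows "(\<Sum>i\<in>I. card {j \<in> J. Q i j}) = (\<Sum>j\<in>J. card {i \<in> I. Q i j})"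
  using sum.swap[of "\<lambda>i j. of_bool (Q i j) :: nat" J I] assms
  by (simp add: sum_of_bool_eq Int_def conj_commute)

lemma opt_loss_le_grid:
  fixes X :: "'a set"
  assumes X: "countable X" and F: "F \<subseteq> X \<rightarrow> {0..1}" and \<gamma>: "\<gamma> > 0" and m: "m > 0"
    and d: "fatV X F \<gamma> = enat d" and N: "N > 0"
  shows "opt_loss X F m \<le> ennreal (real d / real m + \<gamma> + 1 / real N)"
proof -
  define r where "r = (\<lambda>k. real k / real N)"
  have r: "r k \<in> {0..1}" if "k < N" for k using that by (simp add: r_def)
  have "\<forall>k\<in>{..<N}. \<exists>pr. \<forall>f\<in>F. \<forall>x\<in>{1..m} \<rightarrow> X.
    card {i \<in> {1..m}. psi (r k) \<gamma> (f (x i)) \<noteq> Star \<and>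
      vote pr (r k) \<gamma> ((\<lambda>j. (x j, f (x j))) ` ({1..m} - {i})) (x i)
        \<noteq> (psi (r k) \<gamma> (f (x i)) = One)} \<le> d"
    using vote_mistakes[OF r d finite_atLeastAtMost] by blast
  then obtain pr where pr: "\<And>k f x. \<lbrakk>k < N; f \<in> F; x \<in> {1..m} \<rightarrow> X\<rbrakk> \<Longrightarrow>
    card {i \<in> {1..m}. psi (r k) \<gamma> (f (x i)) \<noteq> Star \<and>
      vote (pr k) (r k) \<gamma> ((\<lambda>j. (x j, f (x j))) ` ({1..m} - {i})) (x i)
        \<noteq> (psi (r k) \<gamma> (f (x i)) = One)} \<le> d"
    unfolding bchoice_iff by blast
  \<comment> \<open>Passing \<open>set l\<close> discards order and multiplicity, so the reordering
    of the sample by \<open>swap\<close> does not affect the votes.\<close>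
  define A where "A = (\<lambda>(l, x). real (card {k \<in> {..<N}. vote (pr k) (r k) \<gamma> (set l) x}) / real N)"
  have "card {k \<in> {..<N}. Q k} \<le> N" for Q
    using card_mono[of "{..<N}" "{k \<in> {..<N}. Q k}"] by (simp add: subset_iff)
  then have "A \<in> prediction_strategies X"
    using N by (auto simp: A_def prediction_strategies_def)
  moreover have "expected_error A D f m \<le> ennreal (real d / real m + \<gamma> + 1 / real N)"
    if D: "D \<in> distributions X" and f: "f \<in> F" for D f
  proof (rule expected_error_le[OF X D m])
    fix x assume x: "x \<in> {1..m} \<rightarrow> X"
    define Q where "Q = (\<lambda>i k. psi (r k) \<gamma> (f (x i)) \<noteq> Star \<and>
      vote (pr k) (r k) \<gamma> ((\<lambda>j. (x j, f (x j))) ` ({1..m} - {i})) (x i)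
        \<noteq> (psi (r k) \<gamma> (f (x i)) = One))"
    have "\<bar>A (map (\<lambda>k. (x (swap i m k), f (x (swap i m k)))) [1..<m], x i) - f (x i)\<bar>
        \<le> \<gamma> + 1 / real N + real (card {k \<in> {..<N}. Q i k}) / real N" if i: "i \<in> {1..m}" for i
    proof -
      have "swap i m ` {1..<m} = swap i m ` {1..m} - {swap i m m}"
        by (auto simp: transpose_eq_iff)
      also have "\<dots> = {1..m} - {i}" using i by simp
      finally have "(\<lambda>j. (x j, f (x j))) ` swap i m ` {1..<m} = (\<lambda>j. (x j, f (x j))) ` ({1..m} - {i})"
        by (rule arg_cong)
      then have "set (map (\<lambda>k. (x (swap i m k), f (x (swap i m k)))) [1..<m])
          = (\<lambda>j. (x j, f (x j))) ` ({1..m} - {i})"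
        by (simp add: image_image)
      moreover have "f (x i) \<in> {0..1}" using F f x i by blast
      ultimately show ?thesis
        using grid_average_error[OF _ N \<gamma>] by (simp only: A_def prod.case Q_def r_def)
    qed
    then have "(\<Sum>i\<in>{1..m}. \<bar>A (map (\<lambda>k. (x (swap i m k), f (x (swap i m k)))) [1..<m], x i) - f (x i)\<bar>)
        \<le> (\<Sum>i\<in>{1..m}. \<gamma> + 1 / real N + real (card {k \<in> {..<N}. Q i k}) / real N)"
      by (rule sum_mono)
    also have "\<dots> = real m * (\<gamma> + 1 / real N) + real (\<Sum>i\<in>{1..m}. card {k \<in> {..<N}. Q i k}) / real N"
      by (simp add: sum.distrib sum_divide_distrib algebra_simps)
    \<comment> \<open>Double counting: the bound \<open>d\<close> holds per threshold over all test
      positions, not per position over all thresholds.\<close>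
    also have "(\<Sum>i\<in>{1..m}. card {k \<in> {..<N}. Q i k}) = (\<Sum>k<N. card {i \<in> {1..m}. Q i k})"
      by (rule sum_card_swap) auto
    also have "real \<dots> / real N \<le> real (N * d) / real N"
      using sum_bounded_above[of "{..<N}" "\<lambda>k. card {i \<in> {1..m}. Q i k}" d] pr[OF _ f x]
      by (intro divide_right_mono of_nat_mono) (auto simp: Q_def)
    finally show "(\<Sum>i\<in>{1..m}. \<bar>A (map (\<lambda>k. (x (swap i m k), f (x (swap i m k)))) [1..<m], x i) - f (x i)\<bar>)
        \<le> real m * (real d / real m + \<gamma> + 1 / real N)"
      using N m by (simp add: algebra_simps)
  qed
  ultimately show ?thesis
    unfolding opt_loss_def by (intro INF_lower2[of A] SUP_least) auto
qed

theorem theorem1: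
  fixes X :: "'a set" and F :: "('a \<Rightarrow> real) set" and \<gamma> :: real and m :: nat
  assumes "countable X"
    and "F \<subseteq> X \<rightarrow> {0..1}"
    and "\<gamma> > 0"
    and "m > 0"
  shows "opt_loss X F m \<le> ennreal_of_enat (fatV X F \<gamma>) / of_nat m + ennreal \<gamma>"
proof (cases "fatV X F \<gamma>")
  case infinity
  then show ?thesis by (simp add: ennreal_top_divide)
next
  case (enat d)
  have rhs: "ennreal_of_enat (fatV X F \<gamma>) / of_nat m + ennreal \<gamma> = ennreal (real d / real m + \<gamma>)"
    using enat assms(3,4)
    by (simp add: ennreal_of_nat_eq_real_of_nat divide_ennreal ennreal_plus)
  have "opt_loss X F m \<le> ennreal (real d / real m + \<gamma>)"
  \<comment> \<open>The grid is refined until its error \<open>1 / N\<close> drops below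
    \<open>e\<close>.\<close>
  proof (rule ennreal_le_epsilon)
    fix e :: real assume "0 < e"
    then obtain N where N: "N > 0" "1 / real N < e"
      by (metis nat_approx_posE zero_less_Suc)
    have "opt_loss X F m \<le> ennreal (real d / real m + \<gamma> + 1 / real N)"
      using assms enat N(1) by (intro opt_loss_le_grid)
    also have "\<dots> \<le> ennreal (real d / real m + \<gamma> + e)"
      using N by (intro ennreal_leI) simp
    also have "\<dots> = ennreal (real d / real m + \<gamma>) + ennreal e"
      using \<open>0 < e\<close> assms(3) by (intro ennreal_plus) auto
    finally show "opt_loss X F m \<le> ennreal (real d / real m + \<gamma>) + ennreal e" .
  qed
  then show ?thesis using rhs by simp
qed

end
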